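(* Suppose $X_{t-1}\in S_n$, let $d_{t-1}>0$, and let $\overline r_{t-1}$ be an integer with $0\le\overline r_{t-1}\le n$. Let $r_t=r_{d_{t-1}}(X_{t-1})$, let $\widehat r_t$ be the efficient rank determined by $(X_{t-1},d_{t-1},\overline r_{t-1})$, and let $$Y_t=\mathcal H(X_{t-1},\nabla f(X_{t-1}),d_{t-1},r_t),\qquad \widehat Y_t=\mathcal H(X_{t-1},\nabla f(X_{t-1}),d_{t-1},\widehat r_t).$$ Then $$\widehat Y_t\in\mathcal C_{\widehat r_t}(\nabla f(X_{t-1}))\subseteq S_n,$$ and $$\langle\nabla f(X_{t-1}),\widehat Y_t\rangle\le\langle\nabla f(X_{t-1}),Y_t\rangle\le\langle\nabla f(X_{t-1}),X\rangle\qquad\forall\,X\in S_n\cap S(X_{t-1},d_{t-1}).$$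
   Context: $\mathbb{S}^n$ is the space of real symmetric $n\times n$ matrices with the trace inner product $\langle\cdot,\cdot\rangle$. For any integer $r\ge1$, $S_r=\{S\in\mathbb{S}^r : \operatorname{tr}(S)=1,\ S\succeq0\}$; in particular $S_n$ is the spectrahedron. $f:\mathbb{S}^n\to\mathbb{R}$ is convex and $L$-smooth over $S_n$, i.e. $\|\nabla f(X)-\nabla f(Y)\|_F\le L\|X-Y\|_F$ for $X,Y\in S_n$. $\Delta_n=\{x\in\mathbb{R}^n: x_i\ge0,\ \sum_i x_i=1\}$, $\mathcal O_n$ is the orthogonal group, $[k]=\{1,\dots,k\}$ (so $[0]=\emptyset$), $\mathbf 1_n$ the all-ones vector. For $A\in\mathbb{S}^n$, $\lambda_1(A)\ge\dots\ge\lambda_n(A)$ are its eigenvalues and $\boldsymbol\lambda(A)=(\lambda_1(A),\dots,\lambda_n(A))^T$; for $X\in S_n$ we set $\lambda_{n+1}(X):=0$. Simplex ball: $\Delta(x,d):=\{x-d\mathbf 1_n+nd\,\boldsymbol\lambda : \boldsymbol\lambda\in\Delta_n\}$. Spectral ball: $S(X,d):=\{Q\operatorname{diag}(\boldsymbol\lambda)Q^T : Q\in\mathcal O_n,\ \boldsymbol\lambda\in\Delta(\boldsymbol\lambda(X),d)\}$ for $X\in S_n$, $d>0$. Thresholding rank: $r_d(X):=\max\{i\in[n] : \lambda_i(X)>d\}$, with $\max\emptyset=0$. Efficient rank: given $X_{t-1}$, $d_{t-1}$ and an integer $\overline r_{t-1}\ge0$ (in the algorithms, the maximum of the previously computed efficient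 ranks), $$\widehat r_t=\begin{cases}\max\{i\in[\overline r_{t-1}] : \lambda_i(X_{t-1})>d_{t-1}\} & \text{if } d_{t-1}\ge\lambda_{\overline r_{t-1}+1}(X_{t-1}),\\ \overline r_{t-1}+1&\text{otherwise,}\end{cases}$$ with $\max\emptyset=0$ (in the first case $\widehat r_t=r_t$). For $G\in\mathbb{S}^n$ fix an orthonormal basis of eigenvectors $v_1,\dots,v_n$ with $Gv_i=\lambda_i(G)v_i$ and let $V_r=[v_n,v_{n-1},\dots,v_{n-r+1}]\in\mathbb{R}^{n\times r}$ (eigenvectors for the $r$ smallest eigenvalues). The thresholding mapping is $$\mathcal H(X,G,d,r):=V_r(\Lambda_r-dI_r)V_r^T+n\widehat d\,v_nv_n^T,\quad \Lambda_r=\operatorname{diag}\{\lambda_1(X),\dots,\lambda_r(X)\},\quad \widehat d=\tfrac1n\Big(1+rd-\sum_{i=1}^r\lambda_i(X)\Big),$$ with $\mathcal H(X,G,d,0)=v_nv_n^T$. The spectral $r$th set is $\mathcal C_r(G):=\{V_rSV_r^T : S\in S_r\}$ for $r\ge1$, and $\mathcal C_0(G):=\mathcal C_1(G)=\{v_nv_n^T\}$. For $G=\nabla f(X_{t-1})$ the same eigenbasis is used throughout. *)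

theory Defs
  imports "Jordan_Normal_Form.Char_Poly"
begin

definition Sym :: "nat \<Rightarrow> real mat set" where
  "Sym n = {A \<in> carrier_mat n n. A\<^sup>T = A}"

definition mat_trace :: "real mat \<Rightarrow> real" where
  "mat_trace A = (\<Sum>i<dim_row A. A $$ (i, i))"

definition mat_inner :: "real mat \<Rightarrow> real mat \<Rightarrow> real" where
  "mat_inner A B = mat_trace (A\<^sup>T * B)"

definition frob_norm :: "real mat \<Rightarrow> real" where
  "frob_norm A = sqrt (mat_inner A A)"

definition pos_semidef :: "real mat \<Rightarrow> bool" where
  "pos_semidef A \<longleftrightarrow> (\<forall>x \<in> carrier_vec (dim_row A). 0 \<le> x \<bullet> (A *\<^sub>v x))"

definition Spectrahedron :: "nat \<Rightarrow> real mat set" where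
  "Spectrahedron r = {S \<in> Sym r. mat_trace S = 1 \<and> pos_semidef S}"

text \<open>The library predicate \<^const>\<open>orthogonal_mat\<close> does not require the columns to be
  normalised, so it does not describe the orthogonal group.\<close>

definition Orth :: "nat \<Rightarrow> real mat set" where
  "Orth n = {Q \<in> carrier_mat n n. Q\<^sup>T * Q = 1\<^sub>m n}"

text \<open>The type of matrices of variable dimension is not a normed space, so the Frechet gradient
  in the Euclidean space of symmetric matrices is spelled out.  Only the values of \<open>f\<close> on
  \<^term>\<open>Sym n\<close> matter.\<close>

definition has_gradient :: "nat \<Rightarrow> (real mat \<Rightarrow> real) \<Rightarrow> real mat \<Rightarrow> real mat \<Rightarrow> bool" where
  "has_gradient n f X G \<longleftrightarrow> G \<in> Sym n \<and>
     (\<forall>e>0. \<exists>\<delta>>0. \<forall>Y \<in> Sym n. frob_norm (Y - X) < \<delta> \<longrightarrow>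
        \<bar>f Y - f X - mat_inner G (Y - X)\<bar> \<le> e * frob_norm (Y - X))"

definition grad :: "nat \<Rightarrow> (real mat \<Rightarrow> real) \<Rightarrow> real mat \<Rightarrow> real mat" where
  "grad n f X = (THE G. has_gradient n f X G)"

definition convex_over :: "real mat set \<Rightarrow> (real mat \<Rightarrow> real) \<Rightarrow> bool" where
  "convex_over K f \<longleftrightarrow> (\<forall>X \<in> K. \<forall>Y \<in> K. \<forall>t. 0 \<le> t \<and> t \<le> 1 \<longrightarrow>
     f ((1 - t) \<cdot>\<^sub>m X + t \<cdot>\<^sub>m Y) \<le> (1 - t) * f X + t * f Y)"

definition smooth_over :: "nat \<Rightarrow> real \<Rightarrow> real mat set \<Rightarrow> (real mat \<Rightarrow> real) \<Rightarrow> bool" where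
  "smooth_over n L K f \<longleftrightarrow> (\<forall>X \<in> K. \<exists>G. has_gradient n f X G) \<and>
     (\<forall>X \<in> K. \<forall>Y \<in> K. frob_norm (grad n f X - grad n f Y) \<le> L * frob_norm (X - Y))"

text \<open>Eigenvalues are counted with multiplicity; for a symmetric \<open>n \<times> n\<close> matrix the list below
  has length \<open>n\<close>.\<close>

definition eig_list :: "real mat \<Rightarrow> real list" where
  "eig_list A = rev (sorted_list_of_multiset (proots (char_poly A)))"

text \<open>\<open>eigval A i\<close> is the \<open>i\<close>-th largest eigenvalue, counting from 1, with the convention that
  it is \<open>0\<close> for \<open>i = n + 1\<close>.\<close>

definition eigval :: "real mat \<Rightarrow> nat \<Rightarrow> real" where
  "eigval A i = (if 1 \<le> i \<and> i \<le> dim_row A then eig_list A ! (i - 1) else 0)"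

definition eigval_vec :: "real mat \<Rightarrow> real vec" where
  "eigval_vec A = vec (dim_row A) (\<lambda>i. eigval A (i + 1))"

definition Simplex :: "nat \<Rightarrow> real vec set" where
  "Simplex n = {x \<in> carrier_vec n. (\<forall>i<n. 0 \<le> x $ i) \<and> (\<Sum>i<n. x $ i) = 1}"

definition simplex_ball :: "nat \<Rightarrow> real vec \<Rightarrow> real \<Rightarrow> real vec set" where
  "simplex_ball n x d =
     {x - d \<cdot>\<^sub>v vec n (\<lambda>_. 1) + (real n * d) \<cdot>\<^sub>v l | l. l \<in> Simplex n}"

definition spectral_ball :: "nat \<Rightarrow> real mat \<Rightarrow> real \<Rightarrow> real mat set" where
  "spectral_ball n X d =
     {Q * mat_diag n (\<lambda>i. l $ i) * Q\<^sup>T | Q l. Q \<in> Orth n \<and> l \<in> simplex_ball n (eigval_vec X) d}"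

definition max_or_zero :: "nat set \<Rightarrow> nat" where
  "max_or_zero I = (if I = {} then 0 else Max I)"

definition thresh_rank :: "nat \<Rightarrow> real \<Rightarrow> real mat \<Rightarrow> nat" where
  "thresh_rank n d X = max_or_zero {i \<in> {1..n}. eigval X i > d}"

definition efficient_rank :: "real mat \<Rightarrow> real \<Rightarrow> nat \<Rightarrow> nat" where
  "efficient_rank X d rbar =
     (if d \<ge> eigval X (rbar + 1) then max_or_zero {i \<in> {1..rbar}. eigval X i > d}
      else rbar + 1)"

definition eigenbasis :: "nat \<Rightarrow> real mat \<Rightarrow> (nat \<Rightarrow> real vec) \<Rightarrow> bool" where
  "eigenbasis n G v \<longleftrightarrow>
     (\<forall>i \<in> {1..n}. v i \<in> carrier_vec n \<and> G *\<^sub>v v i = eigval G i \<cdot>\<^sub>v v i) \<and>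
     (\<forall>i \<in> {1..n}. \<forall>j \<in> {1..n}. v i \<bullet> v j = (if i = j then 1 else 0))"

text \<open>The thresholding mapping and the spectral sets depend on the matrix \<open>G\<close> only through the
  chosen eigenbasis \<open>v 1, \<dots>, v n\<close>, which therefore is the argument of the following functions.\<close>

definition Vmat :: "nat \<Rightarrow> (nat \<Rightarrow> real vec) \<Rightarrow> nat \<Rightarrow> real mat" where
  "Vmat n v r = mat_of_cols n (map (\<lambda>j. v (n - j)) [0..<r])"

definition outer_sq :: "real vec \<Rightarrow> real mat" where
  "outer_sq u = mat (dim_vec u) (dim_vec u) (\<lambda>(i, j). u $ i * u $ j)"

definition dhat :: "nat \<Rightarrow> real mat \<Rightarrow> real \<Rightarrow> nat \<Rightarrow> real" where
  "dhat n X d r = (1 / real n) * (1 + real r * d - (\<Sum>i=1..r. eigval X i))"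

definition thresh_map ::
    "nat \<Rightarrow> (nat \<Rightarrow> real vec) \<Rightarrow> real mat \<Rightarrow> real \<Rightarrow> nat \<Rightarrow> real mat" where
  "thresh_map n v X d r =
     (if r = 0 then outer_sq (v n)
      else Vmat n v r * (mat_diag r (\<lambda>i. eigval X (i + 1)) - d \<cdot>\<^sub>m 1\<^sub>m r) * (Vmat n v r)\<^sup>T
           + (real n * dhat n X d r) \<cdot>\<^sub>m outer_sq (v n))"

definition spectral_set :: "nat \<Rightarrow> (nat \<Rightarrow> real vec) \<Rightarrow> nat \<Rightarrow> real mat set" where
  "spectral_set n v r =
     (let k = (if r = 0 then 1 else r)
      in {Vmat n v k * S * (Vmat n v k)\<^sup>T | S. S \<in> Spectrahedron k})"

end

theory Submission
  imports Defs "Jordan_Normal_Form.Schur_Decomposition"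
begin

text \<open>Write \<open>g j = \<lambda>\<^sub>n\<^sub>-\<^sub>j(G)\<close> for \<open>j < n\<close>, which increases with \<open>j\<close>.  For every rank \<open>k\<close> the
  mapping satisfies \<open>\<langle>G, H(X,G,d,k)\<rangle> = g 0 + (\<Sum>i<k. (\<lambda>\<^sub>i\<^sub>+\<^sub>1(X) - d) * (g i - g 0))\<close>.  The summands with
  \<open>i < r\<close> are nonnegative, so the value grows with \<open>k\<close> up to the thresholding rank \<open>r\<close>, and the
  efficient rank never exceeds \<open>r\<close>.

  A competitor \<open>Q diag(l) Q\<^sup>T\<close> satisfies \<open>l i \<ge> m i = max 0 (\<lambda>\<^sub>i\<^sub>+\<^sub>1(X) - d)\<close> and \<open>(\<Sum>i<n. l i) = 1\<close>.  The
  excess \<open>l i - m i\<close> costs at least \<open>g 0\<close> per unit, while the part \<open>m\<close> costs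
  \<open>\<Sum>i j. m i * w i j * g j\<close> with the doubly stochastic weights \<open>w i j = (q\<^sub>i \<bullet> v\<^sub>n\<^sub>-\<^sub>j)\<^sup>2\<close>, which is at least
  \<open>\<Sum>i. m i * g i\<close> because \<open>m\<close> decreases and \<open>g\<close> increases.\<close>

section \<open>Doubly stochastic weights\<close>

text \<open>A nonnegative decreasing sequence is a nonnegative combination of indicators of initial
  segments, so the partial sums of \<open>a\<close> are the only tests needed.\<close>

lemma sum_mult_antimono_nonneg:
  fixes m a :: "nat \<Rightarrow> real"
  assumes antimono: "\<And>i j. i \<le> j \<Longrightarrow> j < n \<Longrightarrow> m j \<le> m i"
    and nonneg: "\<And>i. i < n \<Longrightarrow> 0 \<le> m i"
    and partial: "\<And>k. k \<le> n \<Longrightarrow> 0 \<le> (\<Sum>i<k. a i)"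
  shows "0 \<le> (\<Sum>i<n. m i * a i)"
proof -
  \<comment> \<open>summation by parts, as an induction\<close>
  have ge: "m k * (\<Sum>i<Suc k. a i) \<le> (\<Sum>i<Suc k. m i * a i)" if "k < n" for k
    using that
  proof (induction k)
    case (Suc k)
    have "m (Suc k) * (\<Sum>i<Suc k. a i) \<le> m k * (\<Sum>i<Suc k. a i)"
      using antimono[of k "Suc k"] partial[of "Suc k"] Suc.prems by (intro mult_right_mono) auto
    also have "\<dots> \<le> (\<Sum>i<Suc k. m i * a i)"
      using Suc by simp
    finally show ?case
      by (simp add: distrib_left)
  qed simp
  show ?thesis
  proof (cases n)
    case (Suc k)
    have "0 \<le> m k * (\<Sum>i<Suc k. a i)"
      using nonneg[of k] partial[of "Suc k"] Suc by simp
    also have "\<dots> \<le> (\<Sum>i<Suc k. m i * a i)"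
      using ge[of k] Suc by simp
    finally show ?thesis
      using Suc by simp
  qed simp
qed

text \<open>The averages of \<open>g\<close> with weights \<open>w\<close> are majorised by
  \<open>g\<close>: the first \<open>k\<close> averages sum to at least the \<open>k\<close>
  smallest values of \<open>g\<close>. The previous lemma then passes from initial segments to the
  weights \<open>m\<close>.\<close>

lemma doubly_stochastic_rearrangement:
  fixes m g :: "nat \<Rightarrow> real" and w :: "nat \<Rightarrow> nat \<Rightarrow> real"
  assumes antimono: "\<And>i j. i \<le> j \<Longrightarrow> j < n \<Longrightarrow> m j \<le> m i"
    and nonneg: "\<And>i. i < n \<Longrightarrow> 0 \<le> m i"
    and mono: "\<And>i j. i \<le> j \<Longrightarrow> j < n \<Longrightarrow> g i \<le> g j"
    and w: "\<And>i j. i < n \<Longrightarrow> j < n \<Longrightarrow> 0 \<le> w i j"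
    and rows: "\<And>i. i < n \<Longrightarrow> (\<Sum>j<n. w i j) = 1"
    and cols: "\<And>j. j < n \<Longrightarrow> (\<Sum>i<n. w i j) = 1"
  shows "(\<Sum>i<n. m i * g i) \<le> (\<Sum>i<n. m i * (\<Sum>j<n. w i j * g j))"
proof -
  have "0 \<le> (\<Sum>i<k. (\<Sum>j<n. w i j * g j) - g i)" if k: "k \<le> n" for k
  proof (cases k)
    case (Suc l)
    \<comment> \<open>The mass that the first \<open>k\<close> rows put on column \<open>j\<close>.
      It lies between 0 and 1 and totals \<open>k\<close>, so the cheapest distribution fills
      exactly the columns up to \<open>l = k - 1\<close>.\<close>
    define c where "c j = (\<Sum>i<k. w i j)" for j
    have c0: "0 \<le> c j" if "j < n" for j
      unfolding c_def using that k by (intro sum_nonneg w) auto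
    have c1: "c j \<le> 1" if "j < n" for j
    proof -
      have "c j \<le> (\<Sum>i<n. w i j)"
        unfolding c_def using that k by (intro sum_mono2 w) auto
      then show ?thesis using cols[OF that] by simp
    qed
    have csum: "(\<Sum>j<n. c j) = real k"
    proof -
      have "(\<Sum>j<n. c j) = (\<Sum>i<k. \<Sum>j<n. w i j)"
        unfolding c_def by (rule sum.swap)
      also have "\<dots> = real k"
        using k rows by simp
      finally show ?thesis .
    qed
    have restrict: "(\<Sum>j<n. (if j < k then h j else 0)) = (\<Sum>j<k. h j)" for h :: "nat \<Rightarrow> real"
    proof -
      have "(\<Sum>j<n. (if j < k then h j else 0)) = (\<Sum>j | j \<in> {..<n} \<and> j < k. h j)"
        by (subst sum.inter_filter) auto
      also have "{j. j \<in> {..<n} \<and> j < k} = {..<k}"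
        using k by auto
      finally show ?thesis .
    qed
    \<comment> \<open>Since \<open>(\<Sum>j<n. c j) = k\<close>, shifting \<open>g\<close> by \<open>g l\<close> changes nothing but makes every
      summand nonnegative.\<close>
    have "(\<Sum>i<k. (\<Sum>j<n. w i j * g j) - g i) = (\<Sum>j<n. c j * g j) - (\<Sum>j<k. g j)"
      unfolding c_def sum_subtractf sum_distrib_right by (subst sum.swap) simp
    also have "\<dots> = (\<Sum>j<n. c j * g j) - (\<Sum>j<n. (if j < k then g j else 0))
        - g l * ((\<Sum>j<n. c j) - (\<Sum>j<n. (if j < k then 1 else 0)))"
      unfolding restrict csum by simp
    also have "\<dots> = (\<Sum>j<n. (c j - (if j < k then 1 else 0)) * (g j - g l))"
      unfolding sum_distrib_left sum_subtractf[symmetric]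
      by (intro sum.cong) (auto simp: algebra_simps)
    also have "0 \<le> \<dots>"
    proof (intro sum_nonneg)
      fix j assume "j \<in> {..<n}"
      then have j: "j < n" by simp
      show "0 \<le> (c j - (if j < k then 1 else 0)) * (g j - g l)"
      proof (cases "j < k")
        case True
        then show ?thesis
          using c1[OF j] mono[of j l] Suc k by (simp add: mult_nonpos_nonpos)
      next
        case False
        then show ?thesis
          using c0[OF j] mono[of l j] j Suc by simp
      qed
    qed
    finally show ?thesis by simp
  qed simp
  then have "0 \<le> (\<Sum>i<n. m i * ((\<Sum>j<n. w i j * g j) - g i))"
    by (intro sum_mult_antimono_nonneg antimono nonneg)
  then show ?thesis
    by (simp add: right_diff_distrib sum_subtractf)
qed

section \<open>Inner products and congruences of matrices\<close>

lemma mat_inner_entries: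
  assumes "A \<in> carrier_mat n n" "B \<in> carrier_mat n n"
  shows "mat_inner A B = (\<Sum>a<n. \<Sum>b<n. A $$ (a, b) * B $$ (a, b))"
proof -
  have "mat_inner A B = (\<Sum>b<n. \<Sum>a<n. A $$ (a, b) * B $$ (a, b))"
    using assms by (auto simp: mat_inner_def mat_trace_def scalar_prod_def atLeast0LessThan
        intro!: sum.cong)
  also have "\<dots> = (\<Sum>a<n. \<Sum>b<n. A $$ (a, b) * B $$ (a, b))"
    by (rule sum.swap)
  finally show ?thesis .
qed

lemma mat_trace_mult_commute:
  assumes "A \<in> carrier_mat n k" "B \<in> carrier_mat k n"
  shows "mat_trace (A * B) = mat_trace (B * A)"
proof -
  have "mat_trace (A * B) = (\<Sum>a<n. \<Sum>i<k. A $$ (a, i) * B $$ (i, a))"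
    using assms by (auto simp: mat_trace_def scalar_prod_def atLeast0LessThan intro!: sum.cong)
  also have "\<dots> = (\<Sum>i<k. \<Sum>a<n. B $$ (i, a) * A $$ (a, i))"
    by (subst sum.swap) (simp add: mult.commute)
  also have "\<dots> = mat_trace (B * A)"
    using assms by (auto simp: mat_trace_def scalar_prod_def atLeast0LessThan intro!: sum.cong)
  finally show ?thesis .
qed

lemma mat_trace_similar:
  assumes "similar_mat_wit A B P Q" "A \<in> carrier_mat n n"
  shows "mat_trace A = mat_trace B"
proof -
  note wit = similar_mat_witD2[OF assms(2) assms(1)]
  have "mat_trace A = mat_trace (Q * (P * B))"
    using wit by (subst wit(3)) (rule mat_trace_mult_commute[of "P * B" n n Q]; auto)
  also have "Q * (P * B) = B"
    using wit by (simp add: assoc_mult_mat[of Q n n P n B n, symmetric])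
  finally show ?thesis .
qed

lemma quadratic_form_entries:
  fixes A :: "real mat"
  assumes "A \<in> carrier_mat n n" "x \<in> carrier_vec n"
  shows "x \<bullet> (A *\<^sub>v x) = (\<Sum>a<n. \<Sum>b<n. A $$ (a, b) * (x $ a * x $ b))"
  using assms by (auto simp: scalar_prod_def atLeast0LessThan sum_distrib_left mult_ac
      intro!: sum.cong)

text \<open>The product is the sum of the rank-one matrices of the columns of \<open>U\<close>,
  weighted by \<open>s\<close>. \<open>U\<close> may be rectangular, as is \<open>Vmat\<close> with
  fewer than \<open>n\<close> columns.\<close>

lemma congruence_diag_entry:
  fixes U :: "real mat"
  assumes U: "U \<in> carrier_mat n k" and "a < n" "b < n"
  shows "(U * mat_diag k s * U\<^sup>T) $$ (a, b) = (\<Sum>i<k. s i * (U $$ (a, i) * U $$ (b, i)))"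
  using assms unfolding mat_diag_mult_right[OF U]
  by (auto simp: scalar_prod_def atLeast0LessThan mult_ac intro!: sum.cong)

lemma mat_inner_congruence_diag:
  assumes A: "A \<in> carrier_mat n n" and U: "U \<in> carrier_mat n k"
  shows "mat_inner A (U * mat_diag k s * U\<^sup>T) = (\<Sum>i<k. s i * (col U i \<bullet> (A *\<^sub>v col U i)))"
proof -
  have "mat_inner A (U * mat_diag k s * U\<^sup>T)
      = (\<Sum>a<n. \<Sum>b<n. \<Sum>i<k. s i * (A $$ (a, b) * (U $$ (a, i) * U $$ (b, i))))"
    using A U by (subst mat_inner_entries[of _ n])
      (auto simp: congruence_diag_entry[OF U] sum_distrib_left mult_ac
        simp del: index_mult_mat intro!: sum.cong mult_carrier_mat)
  also have "\<dots> = (\<Sum>a<n. \<Sum>i<k. \<Sum>b<n. s i * (A $$ (a, b) * (U $$ (a, i) * U $$ (b, i))))"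
    by (intro sum.cong refl sum.swap)
  also have "\<dots> = (\<Sum>i<k. \<Sum>a<n. \<Sum>b<n. s i * (A $$ (a, b) * (U $$ (a, i) * U $$ (b, i))))"
    by (rule sum.swap)
  also have "\<dots> = (\<Sum>i<k. s i * (col U i \<bullet> (A *\<^sub>v col U i)))"
    using A U by (intro sum.cong refl, subst quadratic_form_entries[of _ n])
      (auto simp: sum_distrib_left)
  finally show ?thesis .
qed

text \<open>With different choices of \<open>U\<close> and \<open>s\<close> this gives Parseval's
  identity, the spectral formula for \<open>G\<close>, and the value of a competitor's form at its
  own eigenvectors.\<close>

lemma quadratic_form_congruence_diag:
  fixes U :: "real mat"
  assumes U: "U \<in> carrier_mat n k" and x: "x \<in> carrier_vec n"
  shows "x \<bullet> ((U * mat_diag k s * U\<^sup>T) *\<^sub>v x) = (\<Sum>i<k. s i * (x \<bullet> col U i)\<^sup>2)"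
proof -
  have carr: "U * mat_diag k s * U\<^sup>T \<in> carrier_mat n n"
    using U by (auto intro!: mult_carrier_mat)
  have "x \<bullet> ((U * mat_diag k s * U\<^sup>T) *\<^sub>v x)
      = (\<Sum>a<n. \<Sum>b<n. \<Sum>i<k. s i * (x $ a * U $$ (a, i) * (x $ b * U $$ (b, i))))"
    unfolding quadratic_form_entries[OF carr x]
    by (auto simp: congruence_diag_entry[OF U] sum_distrib_left sum_distrib_right mult_ac
        simp del: index_mult_mat intro!: sum.cong)
  also have "\<dots> = (\<Sum>a<n. \<Sum>i<k. \<Sum>b<n. s i * (x $ a * U $$ (a, i) * (x $ b * U $$ (b, i))))"
    by (intro sum.cong refl sum.swap)
  also have "\<dots> = (\<Sum>i<k. \<Sum>a<n. \<Sum>b<n. s i * (x $ a * U $$ (a, i) * (x $ b * U $$ (b, i))))"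
    by (rule sum.swap)
  also have "\<dots> = (\<Sum>i<k. s i * (x \<bullet> col U i)\<^sup>2)"
  proof (intro sum.cong refl)
    fix i assume "i \<in> {..<k}"
    then have "x \<bullet> col U i = (\<Sum>a<n. x $ a * U $$ (a, i))"
      using U x by (simp add: scalar_prod_def atLeast0LessThan)
    then show "(\<Sum>a<n. \<Sum>b<n. s i * (x $ a * U $$ (a, i) * (x $ b * U $$ (b, i))))
        = s i * (x \<bullet> col U i)\<^sup>2"
      by (simp only: power2_eq_square sum_product) (simp only: sum_distrib_left)
  qed
  finally show ?thesis .
qed

lemma transpose_mult_self_entry:
  fixes U :: "real mat"
  assumes "U \<in> carrier_mat n k" "i < k" "j < k"
  shows "(U\<^sup>T * U) $$ (i, j) = col U i \<bullet> col U j"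
  using assms by simp

lemma quadratic_form_transpose:
  fixes U S :: "real mat"
  assumes U: "U \<in> carrier_mat n k" and S: "S \<in> carrier_mat k k" and x: "x \<in> carrier_vec n"
  shows "x \<bullet> ((U * S * U\<^sup>T) *\<^sub>v x) = (U\<^sup>T *\<^sub>v x) \<bullet> (S *\<^sub>v (U\<^sup>T *\<^sub>v x))"
proof -
  have "(U * S * U\<^sup>T) *\<^sub>v x = U *\<^sub>v (S *\<^sub>v (U\<^sup>T *\<^sub>v x))"
    using assms by (simp add: assoc_mult_mat_vec[of _ n k _ n] assoc_mult_mat_vec[of _ n k _ k])
  then show ?thesis
    using assms by (simp add: transpose_vec_mult_scalar[OF U])
qed

text \<open>\<open>U\<close> is an isometric embedding: cyclicity of the trace cancels it, and the
  form at \<open>x\<close> is the form of \<open>S\<close> at the transpose of \<open>U\<close>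
  applied to \<open>x\<close>.\<close>

lemma Spectrahedron_congruence:
  assumes U: "U \<in> carrier_mat n k" and UU: "U\<^sup>T * U = 1\<^sub>m k" and S: "S \<in> Spectrahedron k"
  shows "U * S * U\<^sup>T \<in> Spectrahedron n"
proof -
  have Sk: "S \<in> carrier_mat k k" and ST: "S\<^sup>T = S"
    using S by (auto simp: Spectrahedron_def Sym_def)
  have carr: "U * S * U\<^sup>T \<in> carrier_mat n n"
    using U Sk by (auto intro!: mult_carrier_mat)
  have "(U * S * U\<^sup>T)\<^sup>T = U * (U * S)\<^sup>T"
    using U Sk by (subst transpose_mult[of _ n k _ n]) auto
  also have "\<dots> = U * (S * U\<^sup>T)"
    using U Sk ST by (subst transpose_mult[of _ n k _ k]) auto
  also have "\<dots> = U * S * U\<^sup>T"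
    using U Sk by (subst assoc_mult_mat[of _ n k _ k _ n]) auto
  finally have sym: "(U * S * U\<^sup>T)\<^sup>T = U * S * U\<^sup>T" .
  have "mat_trace (U * S * U\<^sup>T) = mat_trace (U\<^sup>T * (U * S))"
    using U Sk by (intro mat_trace_mult_commute[of _ n k]) auto
  also have "U\<^sup>T * (U * S) = S"
    using U Sk UU by (subst assoc_mult_mat[of _ k n _ k _ k, symmetric]) auto
  finally have trace: "mat_trace (U * S * U\<^sup>T) = 1"
    using S by (simp add: Spectrahedron_def)
  have "0 \<le> x \<bullet> ((U * S * U\<^sup>T) *\<^sub>v x)" if "x \<in> carrier_vec n" for x
    unfolding quadratic_form_transpose[OF U Sk that]
    using S U Sk that by (auto simp: pos_semidef_def Spectrahedron_def)
  then have "pos_semidef (U * S * U\<^sup>T)"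
    using U by (simp add: pos_semidef_def)
  then show ?thesis
    using carr sym trace by (simp add: Spectrahedron_def Sym_def)
qed

lemma Spectrahedron_diag:
  assumes "\<And>i. i < k \<Longrightarrow> 0 \<le> s i" and "(\<Sum>i<k. s i) = 1"
  shows "mat_diag k s \<in> Spectrahedron k"
proof -
  \<comment> \<open>With the identity matrix as \<open>U\<close>, the form is a sum of squares
    weighted by \<open>s\<close>.\<close>
  have "0 \<le> x \<bullet> (mat_diag k s *\<^sub>v x)" if x: "x \<in> carrier_vec k" for x
    using quadratic_form_congruence_diag[of "1\<^sub>m k" k k x s] x assms
    by (auto simp: mat_diag_dim[of k s, THEN left_mult_one_mat]
        mat_diag_dim[of k s, THEN right_mult_one_mat] intro!: sum_nonneg)
  then show ?thesis
    using assms unfolding Spectrahedron_def Sym_def pos_semidef_def mat_trace_def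
    by (auto simp: mat_diag_def)
qed

section \<open>Eigenvalues of symmetric matrices\<close>

lemma proots_prod_linear:
  fixes es :: "'a :: idom list"
  shows "proots (\<Prod>a\<leftarrow>es. [:- a, 1:]) = mset es"
proof (induction es)
  case (Cons a es)
  have "(\<Prod>a\<leftarrow>es. [:- a, 1:]) \<noteq> 0"
    by (auto simp: prod_list_zero_iff)
  then show ?case
    using Cons by (simp add: proots_mult del: mult_pCons_left)
qed simp

text \<open>Lets any splitting of the characteristic polynomial, with roots in any order, stand in
  for the sorted list in multiset arguments.\<close>

lemma eig_list_char_poly:
  assumes "char_poly A = (\<Prod>a\<leftarrow>es. [:- a, 1:])"
  shows "mset (eig_list A) = mset es" "length (eig_list A) = length es"
proof -
  show "mset (eig_list A) = mset es"
    by (simp add: eig_list_def assms proots_prod_linear)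
  then show "length (eig_list A) = length es"
    by (metis size_mset)
qed

lemma eigval_antimono:
  assumes "length (eig_list A) = dim_row A" "1 \<le> i" "i \<le> j" "j \<le> dim_row A"
  shows "eigval A j \<le> eigval A i"
proof -
  have "sorted (rev (eig_list A))"
    by (simp add: eig_list_def)
  then show ?thesis
    using assms sorted_rev_nth_mono[of "eig_list A" "i - 1" "j - 1"] by (simp add: eigval_def)
qed

text \<open>The polynomial splits over the complex numbers, and the roots are real because the
  Hermitian form of a real symmetric matrix takes real values.\<close>

lemma char_poly_symmetric_splits:
  fixes A :: "real mat"
  assumes "A \<in> Sym n"
  shows "\<exists>es. char_poly A = (\<Prod>a\<leftarrow>es. [:- a, 1:]) \<and> length es = n"
proof -
  let ?C = "map_mat complex_of_real A"
  have A: "A \<in> carrier_mat n n" and AT: "A\<^sup>T = A"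
    using assms by (auto simp: Sym_def)
  have sym: "A $$ (i, j) = A $$ (j, i)" if "i < n" "j < n" for i j
    using that A by (subst AT[symmetric]) auto
  have C: "?C \<in> carrier_mat n n"
    using A by simp
  obtain as where as: "char_poly ?C = (\<Prod>a\<leftarrow>as. [:- a, 1:])" "length as = n"
    using char_poly_factorized[OF C] by auto
  have real: "complex_of_real (Re a) = a" if "a \<in> set as" for a
  proof -
    have "poly (char_poly ?C) a = 0"
      using that unfolding as by (auto simp: poly_prod_list prod_list_zero_iff o_def)
    then have "eigenvalue ?C a"
      using eigenvalue_root_char_poly[OF C] by simp
    then obtain z where z: "z \<in> carrier_vec n" "z \<noteq> 0\<^sub>v n" "?C *\<^sub>v z = a \<cdot>\<^sub>v z"
      using C unfolding eigenvalue_def eigenvector_def by auto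
    have row: "(\<Sum>j<n. A $$ (i, j) * z $ j) = a * z $ i" if "i < n" for i
      using arg_cong[OF z(3), of "\<lambda>v. v $ i"] z(1) that A
      by (auto simp: scalar_prod_def atLeast0LessThan)
    \<comment> \<open>\<open>N\<close> is the squared norm of the eigenvector \<open>z\<close> and
      \<open>q\<close> the Hermitian form at \<open>z\<close>. The eigenvector equation gives
      \<open>q = a * N\<close>, symmetry gives \<open>cnj q = q\<close>, and \<open>N\<close> is
      nonzero.\<close>
    define N where "N = (\<Sum>i<n. (cmod (z $ i))\<^sup>2)"
    define q where "q = (\<Sum>i<n. cnj (z $ i) * (\<Sum>j<n. A $$ (i, j) * z $ j))"
    have "q = (\<Sum>i<n. cnj (z $ i) * (a * z $ i))"
      by (simp add: q_def row)
    moreover have "of_real N = (\<Sum>i<n. z $ i * cnj (z $ i))"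
      unfolding N_def of_real_sum complex_norm_square ..
    ultimately have q: "q = a * of_real N"
      by (simp add: sum_distrib_left mult_ac)
    have "cnj q = (\<Sum>i<n. \<Sum>j<n. z $ i * (A $$ (i, j) * cnj (z $ j)))"
      by (simp add: q_def sum_distrib_left)
    also have "\<dots> = (\<Sum>j<n. \<Sum>i<n. z $ i * (A $$ (i, j) * cnj (z $ j)))"
      by (rule sum.swap)
    also have "\<dots> = q"
      unfolding q_def sum_distrib_left by (intro sum.cong refl) (simp add: sym)
    finally have "cnj a * of_real N = a * of_real N"
      using q by simp
    moreover have "N \<noteq> 0"
    proof
      assume "N = 0"
      then have "z $ i = 0" if "i < n" for i
        using that by (auto simp: N_def sum_nonneg_eq_0_iff)
      then have "z = 0\<^sub>v n"
        using z(1) by (intro eq_vecI) auto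
      then show False
        using z(2) by simp
    qed
    ultimately have "cnj a = a"
      by simp
    then show ?thesis
      by (simp add: complex_eq_iff)
  qed
  \<comment> \<open>The embedding of real into complex polynomials is injective, so the
    factorisation descends to the reals.\<close>
  interpret cr: map_poly_inj_idom_hom complex_of_real ..
  have "map_poly complex_of_real (char_poly A) = char_poly ?C"
    using A by (simp add: of_real_hom.char_poly_hom)
  also have "\<dots> = (\<Prod>a\<leftarrow>as. map_poly complex_of_real [:- Re a, 1:])"
    unfolding as by (intro arg_cong[where f = prod_list] map_cong refl) (simp add: real)
  also have "\<dots> = map_poly complex_of_real (\<Prod>a\<leftarrow>map Re as. [:- a, 1:])"
    by (simp add: cr.hom_prod_list o_def)
  finally have "char_poly A = (\<Prod>a\<leftarrow>map Re as. [:- a, 1:])"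
    by simp
  then show ?thesis
    using as(2) by (intro exI[of _ "map Re as"]) simp
qed

lemma length_eig_list:
  assumes "A \<in> Sym n"
  shows "length (eig_list A) = n"
  using char_poly_symmetric_splits[OF assms] eig_list_char_poly(2) by auto

text \<open>Schur triangularisation yields a similar matrix with the eigenvalues on its diagonal,
  and similarity preserves the trace.\<close>

lemma sum_eigval:
  assumes "A \<in> Sym n"
  shows "(\<Sum>i=1..n. eigval A i) = mat_trace A"
proof -
  have A: "A \<in> carrier_mat n n"
    using assms by (simp add: Sym_def)
  obtain es where es: "char_poly A = (\<Prod>a\<leftarrow>es. [:- a, 1:])"
    using char_poly_symmetric_splits[OF assms] by auto
  obtain B P Q where "schur_decomposition A es = (B, P, Q)"
    by (metis prod_cases3)
  then have wit: "similar_mat_wit A B P Q" and diag: "diag_mat B = es"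
    using schur_decomposition[OF A es] by auto
  have "(\<Sum>i=1..n. eigval A i) = (\<Sum>i=1..n. eig_list A ! (i - 1))"
    using A by (simp add: eigval_def)
  also have "\<dots> = (\<Sum>i<n. eig_list A ! i)"
    by (rule sum.reindex_bij_witness[of _ Suc "\<lambda>i. i - 1"]) auto
  also have "\<dots> = sum_list (eig_list A)"
    by (simp add: sum_list_sum_nth length_eig_list[OF assms] atLeast0LessThan)
  also have "\<dots> = sum_list es"
    using eig_list_char_poly(1)[OF es] by (metis sum_mset_sum_list)
  also have "\<dots> = mat_trace B"
    by (simp add: diag[symmetric] diag_mat_def mat_trace_def sum_list_sum_nth atLeast0LessThan)
  also have "\<dots> = mat_trace A"
    using mat_trace_similar[OF wit A] by simp
  finally show ?thesis .
qed

text \<open>Positivity is tested on an eigenvector. Indices outside the range fall under the default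
  value 0.\<close>

lemma eigval_nonneg:
  assumes A: "A \<in> Sym n" and psd: "pos_semidef A"
  shows "0 \<le> eigval A i"
proof (cases "1 \<le> i \<and> i \<le> dim_row A")
  case True
  have carr: "A \<in> carrier_mat n n"
    using A by (simp add: Sym_def)
  obtain es where es: "char_poly A = (\<Prod>a\<leftarrow>es. [:- a, 1:])"
    using char_poly_symmetric_splits[OF A] by auto
  have "eigval A i \<in> set (eig_list A)"
    using True carr length_eig_list[OF A] by (auto simp: eigval_def intro!: nth_mem)
  then have "eigval A i \<in> set es"
    using eig_list_char_poly(1)[OF es] by (metis set_mset_mset)
  then have "poly (char_poly A) (eigval A i) = 0"
    unfolding es by (auto simp: poly_prod_list prod_list_zero_iff o_def)
  then obtain x where x: "x \<in> carrier_vec n" "x \<noteq> 0\<^sub>v n" "A *\<^sub>v x = eigval A i \<cdot>\<^sub>v x"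
    using eigenvalue_root_char_poly[OF carr] carr by (auto simp: eigenvalue_def eigenvector_def)
  have "0 \<le> eigval A i * (x \<bullet> x)"
    using psd x carr by (auto simp: pos_semidef_def)
  moreover have "x \<bullet> x > 0"
    using conjugate_square_greater_0_vec[OF x(1)] x(2) by (simp add: conjugate_vec_def)
  ultimately show ?thesis
    by (simp add: zero_le_mult_iff)
qed (auto simp: eigval_def)

lemma eigval_antimono_Sym:
  assumes "A \<in> Sym n" "1 \<le> i" "i \<le> j" "j \<le> n"
  shows "eigval A j \<le> eigval A i"
  using assms length_eig_list[OF assms(1)] by (intro eigval_antimono) (auto simp: Sym_def)

section \<open>Gradients\<close>

text \<open>Makes the description in \<open>grad\<close> meaningful. Two candidates are compared
  along their difference \<open>H\<close>, an admissible direction because both candidates are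
  symmetric.\<close>

lemma has_gradient_unique:
  assumes X: "X \<in> Sym n" and G1: "has_gradient n f X G1" and G2: "has_gradient n f X G2"
  shows "G1 = G2"
proof -
  have S1: "G1 \<in> Sym n" and S2: "G2 \<in> Sym n"
    using G1 G2 by (auto simp: has_gradient_def)
  have C: "X \<in> carrier_mat n n" "G1 \<in> carrier_mat n n" "G2 \<in> carrier_mat n n"
    using X S1 S2 by (auto simp: Sym_def)
  define H where "H = G1 - G2"
  have H: "H \<in> carrier_mat n n"
    using C by (auto simp: H_def)
  define N where "N = mat_inner H H"
  have N_sum: "N = (\<Sum>a<n. \<Sum>b<n. (H $$ (a, b))\<^sup>2)"
    unfolding N_def mat_inner_entries[OF H H] by (simp add: power2_eq_square)
  have N0: "0 \<le> N"
    unfolding N_sum by (intro sum_nonneg) auto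
  have "N = 0"
  proof (rule ccontr)
    assume "N \<noteq> 0"
    \<comment> \<open>With this \<open>e\<close> the two error bounds add up to half of
      \<open>t * N\<close>, whereas the two linear terms differ by all of it.\<close>
    define e where "e = sqrt N / 4"
    have sq: "0 < sqrt N" and e: "0 < e"
      using N0 \<open>N \<noteq> 0\<close> by (auto simp: e_def)
    obtain \<delta>1 where \<delta>1: "0 < \<delta>1" "\<And>Y. Y \<in> Sym n \<Longrightarrow> frob_norm (Y - X) < \<delta>1 \<Longrightarrow>
        \<bar>f Y - f X - mat_inner G1 (Y - X)\<bar> \<le> e * frob_norm (Y - X)"
      using G1 e unfolding has_gradient_def by meson
    obtain \<delta>2 where \<delta>2: "0 < \<delta>2" "\<And>Y. Y \<in> Sym n \<Longrightarrow> frob_norm (Y - X) < \<delta>2 \<Longrightarrow>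
        \<bar>f Y - f X - mat_inner G2 (Y - X)\<bar> \<le> e * frob_norm (Y - X)"
      using G2 e unfolding has_gradient_def by meson
    \<comment> \<open>Places \<open>Y\<close> at half the smaller of the two radii from
      \<open>X\<close>.\<close>
    define t where "t = min \<delta>1 \<delta>2 / (2 * sqrt N)"
    have t: "0 < t"
      using \<delta>1 \<delta>2 sq by (simp add: t_def)
    have "t * sqrt N = min \<delta>1 \<delta>2 / 2"
      using sq by (simp add: t_def)
    then have small: "t * sqrt N < \<delta>1" "t * sqrt N < \<delta>2"
      using \<delta>1(1) \<delta>2(1) by linarith+
    define Y where "Y = X + t \<cdot>\<^sub>m H"
    have diff: "Y - X = t \<cdot>\<^sub>m H"
      using C H by (auto simp: Y_def intro!: eq_matI)
    have "Y\<^sup>T = X\<^sup>T + t \<cdot>\<^sub>m (G1\<^sup>T - G2\<^sup>T)"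
      using C by (auto simp: Y_def H_def intro!: eq_matI)
    then have Y: "Y \<in> Sym n"
      using X S1 S2 C by (auto simp: Sym_def Y_def H_def)
    have "mat_inner (t \<cdot>\<^sub>m H) (t \<cdot>\<^sub>m H) = t\<^sup>2 * N"
      unfolding N_def using H
      by (simp add: mat_inner_entries[of _ n] sum_distrib_left power2_eq_square mult_ac)
    then have norm: "frob_norm (Y - X) = t * sqrt N"
      using t by (simp add: frob_norm_def diff real_sqrt_mult)
    have inner: "mat_inner G1 (Y - X) - mat_inner G2 (Y - X) = t * N"
      unfolding diff N_def using H C
      by (simp add: mat_inner_entries[of _ n] sum_subtractf[symmetric] sum_distrib_left
          H_def algebra_simps)
    have "t * N \<le> 2 * (e * (t * sqrt N))"
      using \<delta>1(2)[OF Y] \<delta>2(2)[OF Y] small inner unfolding norm by linarith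
    also have "\<dots> = t * N / 2"
      using N0 by (simp add: e_def)
    finally show False
      using t N0 \<open>N \<noteq> 0\<close> by (simp add: mult_le_0_iff)
  qed
  then have "H $$ (a, b) = 0" if "a < n" "b < n" for a b
    using that unfolding N_sum by (simp add: sum_nonneg_eq_0_iff sum_nonneg)
  then show ?thesis
    using C by (intro eq_matI) (auto simp: H_def)
qed

text \<open>Smoothness supplies existence and the previous lemma uniqueness, so the description
  \<open>THE\<close> denotes an actual gradient.\<close>

lemma grad_Sym:
  assumes "smooth_over n L K f" "X \<in> K" "X \<in> Sym n"
  shows "grad n f X \<in> Sym n"
proof -
  have "\<exists>!G. has_gradient n f X G"
    using assms has_gradient_unique[OF assms(3)] unfolding smooth_over_def by blast
  then have "has_gradient n f X (grad n f X)"
    unfolding grad_def by (rule theI')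
  then show ?thesis
    by (simp add: has_gradient_def)
qed

section \<open>Orthonormal bases\<close>

lemma Orth_mult_transpose:
  assumes "Q \<in> Orth n"
  shows "Q * Q\<^sup>T = 1\<^sub>m n"
  using assms mat_mult_left_right_inverse[of "Q\<^sup>T" n Q] by (auto simp: Orth_def)

lemma Orth_col_scalar_prod:
  assumes "Q \<in> Orth n" "i < n" "j < n"
  shows "col Q i \<bullet> col Q j = (if i = j then 1 else 0)"
  using assms transpose_mult_self_entry[of Q n n i j] by (simp add: Orth_def)

text \<open>Parseval's identity, from the congruence with unit weights. It later yields the row and
  column sums of the doubly stochastic weights.\<close>

lemma Orth_sum_squares:
  assumes W: "W \<in> Orth n" and x: "x \<in> carrier_vec n"
  shows "(\<Sum>j<n. (x \<bullet> col W j)\<^sup>2) = x \<bullet> x"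
proof -
  have Wc: "W \<in> carrier_mat n n"
    using W by (simp add: Orth_def)
  have "W * mat_diag n (\<lambda>_. 1) * W\<^sup>T = 1\<^sub>m n"
    using Wc Orth_mult_transpose[OF W] by simp
  then show ?thesis
    using quadratic_form_congruence_diag[OF Wc x, of "\<lambda>_. 1"] x by simp
qed

lemma Vmat_carrier: "Vmat n v k \<in> carrier_mat n k"
  by (simp add: Vmat_def carrier_matI)

text \<open>Columns count from 0 and the basis from 1: column 0 is \<open>v n\<close>, belonging to
  the smallest eigenvalue.\<close>

lemma col_Vmat:
  assumes "\<And>i. i \<in> {1..n} \<Longrightarrow> v i \<in> carrier_vec n" "i < k" "k \<le> n"
  shows "col (Vmat n v k) i = v (n - i)"
  using assms by (simp add: Vmat_def)

lemma Vmat_orthonormal: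
  assumes "eigenbasis n G v" "k \<le> n"
  shows "(Vmat n v k)\<^sup>T * Vmat n v k = 1\<^sub>m k"
proof (rule eq_matI)
  fix i j assume "i < dim_row (1\<^sub>m k :: real mat)" "j < dim_col (1\<^sub>m k :: real mat)"
  then have ij: "i < k" "j < k" by auto
  have *: "n - i \<in> {1..n}" "n - j \<in> {1..n}" "n - i = n - j \<longleftrightarrow> i = j"
    using ij assms(2) by auto
  have "((Vmat n v k)\<^sup>T * Vmat n v k) $$ (i, j) = v (n - i) \<bullet> v (n - j)"
    using assms ij unfolding transpose_mult_self_entry[OF Vmat_carrier ij]
    by (subst (1 2) col_Vmat) (auto simp: eigenbasis_def)
  also have "\<dots> = (if i = j then 1 else 0)"
    using assms(1) * unfolding eigenbasis_def by metis
  finally show "((Vmat n v k)\<^sup>T * Vmat n v k) $$ (i, j) = 1\<^sub>m k $$ (i, j)"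
    using ij by simp
qed (use Vmat_carrier[of n v k] in auto)

text \<open>The eigenvector equations, read column by column, say \<open>G * W = W * D\<close>;
  orthogonality of \<open>W\<close> moves it to the other side.\<close>

lemma eigenbasis_decomposition:
  assumes G: "G \<in> carrier_mat n n" and v: "eigenbasis n G v"
  shows "G = Vmat n v n * mat_diag n (\<lambda>j. eigval G (n - j)) * (Vmat n v n)\<^sup>T"
proof -
  let ?W = "Vmat n v n" and ?D = "mat_diag n (\<lambda>j. eigval G (n - j))"
  have W: "?W \<in> carrier_mat n n" "?W \<in> Orth n"
    using Vmat_carrier Vmat_orthonormal[OF v] by (auto simp: Orth_def)
  have "G * ?W = ?W * ?D"
  proof (rule eq_matI)
    fix a j assume "a < dim_row (?W * ?D)" "j < dim_col (?W * ?D)"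
    then have aj: "a < n" "j < n"
      using W(1) by (auto simp: mat_diag_def)
    have col: "col ?W j = v (n - j)"
      using aj v by (intro col_Vmat) (auto simp: eigenbasis_def)
    have "(G * ?W) $$ (a, j) = (G *\<^sub>v v (n - j)) $ a"
      using aj G W(1) col by simp
    also have "\<dots> = eigval G (n - j) * v (n - j) $ a"
    proof -
      have "n - j \<in> {1..n}"
        using aj by auto
      then have "v (n - j) \<in> carrier_vec n" "G *\<^sub>v v (n - j) = eigval G (n - j) \<cdot>\<^sub>v v (n - j)"
        using v by (auto simp: eigenbasis_def)
      then show ?thesis
        using aj by simp
    qed
    also have "v (n - j) $ a = ?W $$ (a, j)"
      unfolding col[symmetric] using aj W(1) by simp
    finally show "(G * ?W) $$ (a, j) = (?W * ?D) $$ (a, j)"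
      using aj W(1) by (simp add: mat_diag_mult_right[OF W(1)])
  qed (use G W(1) in \<open>auto simp: mat_diag_def\<close>)
  then have "?W * ?D * ?W\<^sup>T = G * ?W * ?W\<^sup>T"
    by (simp only:)
  also have "\<dots> = G * (?W * ?W\<^sup>T)"
    using G W(1) by (intro assoc_mult_mat[of _ n n _ n _ n]) auto
  finally show ?thesis
    using G Orth_mult_transpose[OF W(2)] by simp
qed

section \<open>The thresholding mapping\<close>

text \<open>The eigenvalues decrease, so the indices above the threshold form an initial segment and
  its maximum determines it.\<close>

lemma thresh_rank_iff:
  assumes "X \<in> Sym n" "i \<in> {1..n}"
  shows "d < eigval X i \<longleftrightarrow> i \<le> thresh_rank n d X"
proof -
  let ?I = "{i \<in> {1..n}. d < eigval X i}"
  show ?thesis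
  proof
    assume "d < eigval X i"
    then have "i \<in> ?I"
      using assms(2) by simp
    then show "i \<le> thresh_rank n d X"
      by (auto simp: thresh_rank_def max_or_zero_def)
  next
    assume le: "i \<le> thresh_rank n d X"
    then have "?I \<noteq> {}"
      using assms(2) by (auto simp: thresh_rank_def max_or_zero_def split: if_splits)
    then have "thresh_rank n d X \<in> ?I"
      using Max_in[of ?I] by (simp add: thresh_rank_def max_or_zero_def)
    then show "d < eigval X i"
      using eigval_antimono_Sym[OF assms(1) _ le] assms(2) by auto
  qed
qed

lemma thresh_rank_le: "thresh_rank n d X \<le> n"
  by (auto simp: thresh_rank_def max_or_zero_def)

text \<open>In the first case the maximum runs over part of the index set of the thresholding rank;
  in the second, \<open>rbar + 1\<close> itself lies in that set.\<close>

lemma efficient_rank_le_thresh_rank: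
  assumes X: "X \<in> Sym n" and d: "0 < d" and rbar: "rbar \<le> n"
  shows "efficient_rank X d rbar \<le> thresh_rank n d X"
proof (cases "eigval X (rbar + 1) \<le> d")
  case True
  let ?I = "{i \<in> {1..rbar}. d < eigval X i}"
  have "\<forall>i \<in> ?I. i \<le> thresh_rank n d X"
    using rbar by (auto simp: thresh_rank_iff[OF X, symmetric])
  then show ?thesis
    using True by (simp add: efficient_rank_def max_or_zero_def)
next
  case False
  \<comment> \<open>\<open>rbar = n\<close> is excluded here, since the convention gives
    \<open>eigval X (n + 1) = 0\<close>, which is below \<open>d\<close>.\<close>
  then have "rbar + 1 \<in> {1..n}"
    using d X by (auto simp: eigval_def Sym_def split: if_splits)
  then show ?thesis
    using False thresh_rank_iff[OF X, of "rbar + 1" d] by (simp add: efficient_rank_def)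
qed

text \<open>Both branches of \<^const>\<open>thresh_map\<close> are \<open>V diag(w) V\<^sup>T\<close> with \<open>max 1 k\<close> columns in \<open>V\<close>: for \<open>k = 0\<close>
  the single weight is \<open>n * dhat = 1\<close>.\<close>

definition thresh_weight :: "nat \<Rightarrow> real mat \<Rightarrow> real \<Rightarrow> nat \<Rightarrow> nat \<Rightarrow> real" where
  "thresh_weight n X d k i =
     (if i < k then eigval X (i + 1) - d else 0) + (if i = 0 then real n * dhat n X d k else 0)"

lemma dhat_eq:
  assumes "0 < n"
  shows "real n * dhat n X d k = 1 - (\<Sum>i<k. eigval X (i + 1) - d)"
  using assms by (simp add: dhat_def sum_subtractf sum.atLeast1_atMost_eq)

text \<open>Index 0 receives whatever is missing to total mass 1. The function \<open>g\<close> is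
  arbitrary because it is later a product of eigenvector coordinates (entries), an eigenvalue of
  \<open>G\<close> (inner product) and the constant 1 (trace).\<close>

lemma sum_thresh_weight:
  assumes "0 < n"
  shows "(\<Sum>i<max 1 k. thresh_weight n X d k i * g i)
    = g 0 + (\<Sum>i<k. (eigval X (i + 1) - d) * (g i - g 0))"
proof -
  have "(\<Sum>i<max 1 k. thresh_weight n X d k i * g i)
      = (\<Sum>i<max 1 k. if i < k then (eigval X (i + 1) - d) * g i else 0)
        + (\<Sum>i<max 1 k. if i = 0 then real n * dhat n X d k * g i else 0)"
    unfolding sum.distrib[symmetric]
    by (intro sum.cong) (auto simp: thresh_weight_def algebra_simps)
  \<comment> \<open>The bound \<open>max 1 k\<close> keeps index 0 in range even for
    \<open>k = 0\<close>.\<close>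
  also have "(\<Sum>i<max 1 k. if i = 0 then real n * dhat n X d k * g i else 0)
      = real n * dhat n X d k * g 0"
    by simp
  also have "(\<Sum>i<max 1 k. if i < k then (eigval X (i + 1) - d) * g i else 0)
      = (\<Sum>i<k. (eigval X (i + 1) - d) * g i)"
    by (intro sum.mono_neutral_cong_right) auto
  finally show ?thesis
    by (simp add: dhat_eq[OF assms] right_diff_distrib left_diff_distrib sum_subtractf
        sum_distrib_right)
qed

lemma thresh_map_congruence:
  assumes n: "0 < n" and v: "\<forall>i \<in> {1..n}. v i \<in> carrier_vec n" and k: "k \<le> n"
  shows "thresh_map n v X d k = Vmat n v (max 1 k)
    * mat_diag (max 1 k) (thresh_weight n X d k) * (Vmat n v (max 1 k))\<^sup>T"
proof (rule eq_matI)
  let ?K = "max 1 k" and ?w = "thresh_weight n X d k"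
  let ?R = "Vmat n v ?K * mat_diag ?K ?w * (Vmat n v ?K)\<^sup>T"
  have vn: "v n \<in> carrier_vec n"
    using v n by simp
  have V: "Vmat n v j \<in> carrier_mat n j" for j
    by (rule Vmat_carrier)
  have entry: "Vmat n v j $$ (a, i) = v (n - i) $ a" if "a < n" "i < j" for a i j
    using that by (simp add: Vmat_def mat_of_cols_index)
  have D: "mat_diag k (\<lambda>i. eigval X (i + 1)) - d \<cdot>\<^sub>m 1\<^sub>m k
      = mat_diag k (\<lambda>i. eigval X (i + 1) - d)"
    by (rule eq_matI) (auto simp: mat_diag_def)
  show "dim_row (thresh_map n v X d k) = dim_row ?R" "dim_col (thresh_map n v X d k) = dim_col ?R"
    using vn V by (auto simp: thresh_map_def outer_sq_def Vmat_def)
  fix a b assume "a < dim_row ?R" "b < dim_col ?R"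
  then have ab: "a < n" "b < n"
    using V[of ?K] by auto
  have "?R $$ (a, b) = (\<Sum>i<?K. ?w i * (v (n - i) $ a * v (n - i) $ b))"
    unfolding congruence_diag_entry[OF V ab] using ab by (simp add: entry)
  also have "\<dots> = (\<Sum>i<k. (eigval X (i + 1) - d) * (v (n - i) $ a * v (n - i) $ b))
      + real n * dhat n X d k * (v n $ a * v n $ b)"
    unfolding sum_thresh_weight[OF n] dhat_eq[OF n]
    by (simp add: right_diff_distrib left_diff_distrib sum_subtractf sum_distrib_right)
  also have "\<dots> = thresh_map n v X d k $$ (a, b)"
  proof (cases "k = 0")
    case True
    then show ?thesis
      using ab vn by (simp add: thresh_map_def outer_sq_def dhat_eq[OF n])
  next
    case False
    have "(Vmat n v k * mat_diag k (\<lambda>i. eigval X (i + 1) - d) * (Vmat n v k)\<^sup>T) $$ (a, b)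
        = (\<Sum>i<k. (eigval X (i + 1) - d) * (v (n - i) $ a * v (n - i) $ b))"
      unfolding congruence_diag_entry[OF V ab] using ab by (simp add: entry)
    then show ?thesis
      using False ab vn V[of k] unfolding thresh_map_def D
      by (simp add: outer_sq_def del: index_mult_mat(1))
  qed
  finally show "thresh_map n v X d k $$ (a, b) = ?R $$ (a, b)" ..
qed

text \<open>The columns are unit eigenvectors, so their quadratic forms are eigenvalues of
  \<open>G\<close>. In this form \<open>k\<close> only sets the number of summands, which makes
  different ranks comparable.\<close>

lemma mat_inner_thresh_map:
  assumes n: "0 < n" and G: "G \<in> carrier_mat n n" and v: "eigenbasis n G v" and k: "k \<le> n"
  shows "mat_inner G (thresh_map n v X d k)
    = eigval G n + (\<Sum>i<k. (eigval X (i + 1) - d) * (eigval G (n - i) - eigval G n))"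
proof -
  have vc: "\<forall>i \<in> {1..n}. v i \<in> carrier_vec n"
    using v by (simp add: eigenbasis_def)
  have eig: "col (Vmat n v (max 1 k)) i \<bullet> (G *\<^sub>v col (Vmat n v (max 1 k)) i) = eigval G (n - i)"
    if "i < max 1 k" for i
  proof -
    have i: "n - i \<in> {1..n}"
      using that k n by auto
    have "col (Vmat n v (max 1 k)) i = v (n - i)"
      using that k n vc by (intro col_Vmat) auto
    moreover have "v (n - i) \<bullet> v (n - i) = 1"
      using v i unfolding eigenbasis_def by metis
    ultimately show ?thesis
      using v vc i by (simp add: eigenbasis_def)
  qed
  have "mat_inner G (thresh_map n v X d k)
      = (\<Sum>i<max 1 k. thresh_weight n X d k i * eigval G (n - i))"
    unfolding thresh_map_congruence[OF n vc k] mat_inner_congruence_diag[OF G Vmat_carrier]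
    using eig by (intro sum.cong) auto
  then show ?thesis
    using sum_thresh_weight[OF n, where g = "\<lambda>i. eigval G (n - i)"] by simp
qed

lemma spectral_set_eq:
  "spectral_set n v k =
    {Vmat n v (max 1 k) * S * (Vmat n v (max 1 k))\<^sup>T | S. S \<in> Spectrahedron (max 1 k)}"
  by (cases "k = 0") (simp_all add: spectral_set_def max_def)

text \<open>Up to the thresholding rank the differences \<open>eigval X (i + 1) - d\<close> are
  positive, and the remainder at index 0 is nonnegative because the leading eigenvalues sum to at
  most the trace 1.\<close>

lemma thresh_map_in_spectral_set:
  assumes n: "0 < n" and X: "X \<in> Spectrahedron n" and d: "0 < d"
    and v: "\<forall>i \<in> {1..n}. v i \<in> carrier_vec n" and k: "k \<le> thresh_rank n d X"
  shows "thresh_map n v X d k \<in> spectral_set n v k"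
proof -
  have XS: "X \<in> Sym n" and psd: "pos_semidef X" and trace: "mat_trace X = 1"
    using X by (auto simp: Spectrahedron_def)
  have kn: "k \<le> n"
    using k thresh_rank_le[of n d X] by simp
  have "(\<Sum>i<k. eigval X (i + 1) - d) \<le> (\<Sum>i<k. eigval X (i + 1))"
    using d by (intro sum_mono) simp
  also have "\<dots> \<le> (\<Sum>i<n. eigval X (i + 1))"
    using kn eigval_nonneg[OF XS psd] by (intro sum_mono2) auto
  also have "\<dots> = 1"
    using sum_eigval[OF XS] trace by (simp add: sum.atLeast1_atMost_eq)
  finally have "0 \<le> real n * dhat n X d k"
    by (simp add: dhat_eq[OF n])
  moreover have "0 \<le> eigval X (i + 1) - d" if "i < k" for i
    using thresh_rank_iff[OF XS, of "i + 1" d] that k kn by simp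
  ultimately have "0 \<le> thresh_weight n X d k i" for i
    by (auto simp: thresh_weight_def)
  moreover have "(\<Sum>i<max 1 k. thresh_weight n X d k i) = 1"
    using sum_thresh_weight[OF n, where g = "\<lambda>_. 1"] by simp
  ultimately have "mat_diag (max 1 k) (thresh_weight n X d k) \<in> Spectrahedron (max 1 k)"
    by (intro Spectrahedron_diag)
  then show ?thesis
    unfolding spectral_set_eq thresh_map_congruence[OF n v kn] by blast
qed

lemma spectral_set_subset_Spectrahedron:
  assumes "0 < n" "eigenbasis n G v" "k \<le> n"
  shows "spectral_set n v k \<subseteq> Spectrahedron n"
proof -
  have "max 1 k \<le> n"
    using assms by simp
  then show ?thesis
    unfolding spectral_set_eq
    using Spectrahedron_congruence[OF Vmat_carrier Vmat_orthonormal[OF assms(2)]] by blast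
qed

text \<open>Both memberships of \<open>Z\<close> enter the bound \<open>m i \<le> l $ i\<close>: the
  ball gives it below the rank \<open>r\<close>, positive semidefiniteness from \<open>r\<close>
  on.\<close>

lemma spectral_ball_inner_ge:
  assumes X: "X \<in> Spectrahedron n" and G: "G \<in> Sym n" and v: "eigenbasis n G v"
    and Z: "Z \<in> Spectrahedron n" "Z \<in> spectral_ball n X d" and n: "0 < n"
    and d: "0 < d"
  shows "mat_inner G (thresh_map n v X d (thresh_rank n d X)) \<le> mat_inner G Z"
proof -
  have XS: "X \<in> Sym n" and trX: "mat_trace X = 1" and Gc: "G \<in> carrier_mat n n"
    and Xc: "X \<in> carrier_mat n n"
    using X G by (auto simp: Spectrahedron_def Sym_def)
  define r where "r = thresh_rank n d X"
  have rn: "r \<le> n"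
    unfolding r_def by (rule thresh_rank_le)
  define W where "W = Vmat n v n"
  define g where "g j = eigval G (n - j)" for j
  have W: "W \<in> carrier_mat n n" "W \<in> Orth n"
    using Vmat_carrier Vmat_orthonormal[OF v] by (auto simp: W_def Orth_def)
  have g_mono: "g i \<le> g j" if "i \<le> j" "j < n" for i j
    unfolding g_def using that by (intro eigval_antimono_Sym[OF G]) auto
  obtain Q l where Q: "Q \<in> Orth n" and l: "l \<in> simplex_ball n (eigval_vec X) d"
    and Z_eq: "Z = Q * mat_diag n (\<lambda>i. l $ i) * Q\<^sup>T"
    using Z(2) by (auto simp: spectral_ball_def)
  have Qc: "Q \<in> carrier_mat n n"
    using Q by (simp add: Orth_def)
  have colQ: "col Q i \<in> carrier_vec n" if "i < n" for i
    using Qc that by auto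
  \<comment> \<open>\<open>l $ i\<close> is the quadratic form of \<open>Z\<close> at its own
    eigenvector \<open>col Q i\<close>.\<close>
  have l_nonneg: "0 \<le> l $ i" if i: "i < n" for i
  proof -
    have "0 \<le> col Q i \<bullet> (Z *\<^sub>v col Q i)"
      using Z(1) colQ[OF i] by (auto simp: Spectrahedron_def pos_semidef_def Sym_def)
    also have "\<dots> = (\<Sum>j<n. l $ j * (col Q i \<bullet> col Q j)\<^sup>2)"
      unfolding Z_eq by (rule quadratic_form_congruence_diag[OF Qc colQ[OF i]])
    also have "\<dots> = (\<Sum>j<n. if i = j then l $ j else 0)"
      using Orth_col_scalar_prod[OF Q i] by (intro sum.cong) auto
    also have "\<dots> = l $ i"
      using i by simp
    finally show ?thesis .
  qed
  obtain \<mu> where \<mu>: "\<mu> \<in> Simplex n"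
    and l_eq: "l = eigval_vec X - d \<cdot>\<^sub>v vec n (\<lambda>_. 1) + (real n * d) \<cdot>\<^sub>v \<mu>"
    using l by (auto simp: simplex_ball_def)
  have l_entry: "l $ i = eigval X (i + 1) - d + real n * d * \<mu> $ i" if "i < n" for i
    using that Xc \<mu> unfolding l_eq by (auto simp: eigval_vec_def Simplex_def)
  \<comment> \<open>The downward shifts by \<open>d\<close> and the added mass \<open>n * d\<close>
    cancel, leaving the trace of \<open>X\<close>.\<close>
  have "(\<Sum>i<n. l $ i) = (\<Sum>i<n. eigval X (i + 1)) - real n * d + real n * d * (\<Sum>i<n. \<mu> $ i)"
    by (simp add: l_entry sum.distrib sum_subtractf sum_distrib_left)
  then have l_sum: "(\<Sum>i<n. l $ i) = 1"
    using \<mu> sum_eigval[OF XS] trX by (simp add: Simplex_def sum.atLeast1_atMost_eq)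
  define m where "m i = (if i < r then eigval X (i + 1) - d else 0)" for i
  define h where "h i = col Q i \<bullet> (G *\<^sub>v col Q i)" for i
  \<comment> \<open>Squared coordinates of one orthonormal basis in another: Parseval in the basis
    \<open>W\<close> gives the row sums, in the basis \<open>Q\<close> the column sums.\<close>
  define w where "w i j = (col Q i \<bullet> col W j)\<^sup>2" for i j
  have w_rows: "(\<Sum>j<n. w i j) = 1" if "i < n" for i
    unfolding w_def Orth_sum_squares[OF W(2) colQ[OF that]]
    using Orth_col_scalar_prod[OF Q that that] by simp
  have w_cols: "(\<Sum>i<n. w i j) = 1" if j: "j < n" for j
  proof -
    have colW: "col W j \<in> carrier_vec n"
      using W(1) j by auto
    have "(\<Sum>i<n. w i j) = (\<Sum>i<n. (col W j \<bullet> col Q i)\<^sup>2)"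
      unfolding w_def using colQ colW by (intro sum.cong) (auto simp: comm_scalar_prod[of _ n])
    then show ?thesis
      using Orth_sum_squares[OF Q colW] Orth_col_scalar_prod[OF W(2) j j] by simp
  qed
  have h_eq: "h i = (\<Sum>j<n. w i j * g j)" if "i < n" for i
  proof -
    have "G = W * mat_diag n g * W\<^sup>T"
      unfolding W_def g_def by (rule eigenbasis_decomposition[OF Gc v])
    then show ?thesis
      unfolding h_def w_def using quadratic_form_congruence_diag[OF W(1) colQ[OF that], of g]
      by (simp add: mult.commute)
  qed
  have h_ge: "g 0 \<le> h i" if i: "i < n" for i
  proof -
    have "g 0 = (\<Sum>j<n. w i j * g 0)"
      using w_rows[OF i] by (simp add: sum_distrib_right[symmetric])
    also have "\<dots> \<le> h i"
      unfolding h_eq[OF i] using g_mono by (intro sum_mono mult_left_mono) (auto simp: w_def)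
    finally show ?thesis .
  qed
  have m_nonneg: "0 \<le> m i" if "i < n" for i
    using thresh_rank_iff[OF XS, of "i + 1" d] that by (auto simp: m_def r_def)
  have m_antimono: "m j \<le> m i" if "i \<le> j" "j < n" for i j
  proof (cases "j < r")
    case True
    then show ?thesis
      using that eigval_antimono_Sym[OF XS, of "i + 1" "j + 1"] by (simp add: m_def)
  next
    case False
    then show ?thesis
      using that m_nonneg[of i] by (simp add: m_def)
  qed
  have m_le: "m i \<le> l $ i" if "i < n" for i
  proof (cases "i < r")
    case True
    have "0 \<le> real n * d * \<mu> $ i"
      using \<mu> that d by (simp add: Simplex_def)
    then show ?thesis
      using True that by (simp add: m_def l_entry)
  next
    case False
    then show ?thesis
      using l_nonneg[OF that] by (simp add: m_def)
  qed
  have "mat_inner G (thresh_map n v X d r)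
      = g 0 + (\<Sum>i<r. (eigval X (i + 1) - d) * (g i - g 0))"
    using mat_inner_thresh_map[OF n Gc v rn] by (simp add: g_def)
  also have "(\<Sum>i<r. (eigval X (i + 1) - d) * (g i - g 0)) = (\<Sum>i<n. m i * (g i - g 0))"
    using rn by (intro sum.mono_neutral_cong_left) (auto simp: m_def)
  \<comment> \<open>The isolated \<open>g 0\<close> is spread over the entries of \<open>l\<close>,
    whose sum is 1.\<close>
  also have "g 0 + \<dots> = (\<Sum>i<n. (l $ i - m i) * g 0) + (\<Sum>i<n. m i * g i)"
    using l_sum
    by (simp add: right_diff_distrib left_diff_distrib sum_subtractf flip: sum_distrib_right)
  also have "\<dots> \<le> (\<Sum>i<n. (l $ i - m i) * h i) + (\<Sum>i<n. m i * (\<Sum>j<n. w i j * g j))"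
  proof (rule add_mono)
    show "(\<Sum>i<n. (l $ i - m i) * g 0) \<le> (\<Sum>i<n. (l $ i - m i) * h i)"
      using m_le h_ge by (intro sum_mono mult_left_mono) auto
    \<comment> \<open>The rearrangement applies to \<open>m\<close>, which is decreasing;
      \<open>l\<close> comes in no particular order.\<close>
    show "(\<Sum>i<n. m i * g i) \<le> (\<Sum>i<n. m i * (\<Sum>j<n. w i j * g j))"
      by (intro doubly_stochastic_rearrangement m_antimono m_nonneg g_mono w_rows w_cols)
        (simp_all add: w_def)
  qed
  also have "\<dots> = (\<Sum>i<n. l $ i * h i)"
    by (simp add: h_eq sum.distrib[symmetric] left_diff_distrib)
  also have "\<dots> = mat_inner G Z"
    unfolding Z_eq mat_inner_congruence_diag[OF Gc Qc] h_def ..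
  finally show ?thesis
    unfolding r_def .
qed

theorem lemma4p1:
  fixes n rbar :: nat and L d :: real and f :: "real mat \<Rightarrow> real" and X :: "real mat"
    and v :: "nat \<Rightarrow> real vec"
  assumes "convex_over (Spectrahedron n) f"
    and "smooth_over n L (Spectrahedron n) f"
    and "X \<in> Spectrahedron n"
    and "0 < d"
    and "rbar \<le> n"
    and "eigenbasis n (grad n f X) v"
  defines "r \<equiv> thresh_rank n d X"
    and "rhat \<equiv> efficient_rank X d rbar"
  defines "Y \<equiv> thresh_map n v X d r"
    and "Yhat \<equiv> thresh_map n v X d rhat"
  shows "Yhat \<in> spectral_set n v rhat
    \<and> spectral_set n v rhat \<subseteq> Spectrahedron n
    \<and> mat_inner (grad n f X) Yhat \<le> mat_inner (grad n f X) Y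
    \<and> (\<forall>Z \<in> Spectrahedron n \<inter> spectral_ball n X d.
         mat_inner (grad n f X) Y \<le> mat_inner (grad n f X) Z)"
proof -
  have X: "X \<in> Sym n"
    using assms(3) by (simp add: Spectrahedron_def)
  \<comment> \<open>For \<open>n = 0\<close> the trace would be an empty sum and could not equal
    1.\<close>
  have n: "0 < n"
    using assms(3) by (cases n) (auto simp: Spectrahedron_def Sym_def mat_trace_def)
  define G where "G = grad n f X"
  have G: "G \<in> Sym n" and Gc: "G \<in> carrier_mat n n"
    using grad_Sym[OF assms(2,3) X] by (auto simp: G_def Sym_def)
  have v: "eigenbasis n G v"
    using assms(6) by (simp add: G_def)
  have le: "rhat \<le> r"
    unfolding r_def rhat_def using X assms(4,5) by (rule efficient_rank_le_thresh_rank)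
  have rn: "r \<le> n"
    unfolding r_def by (rule thresh_rank_le)
  have "mat_inner G Y \<le> mat_inner G Z" if "Z \<in> Spectrahedron n \<inter> spectral_ball n X d" for Z
    unfolding Y_def r_def using that assms(3,4) G v n by (intro spectral_ball_inner_ge) auto
  moreover have "mat_inner G Yhat \<le> mat_inner G Y"
  proof -
    \<comment> \<open>Raising the rank towards \<open>r\<close> adds only such terms: the first
      factor is positive below \<open>r\<close>, and \<open>eigval G n\<close> is the smallest
      eigenvalue.\<close>
    have "0 \<le> (eigval X (i + 1) - d) * (eigval G (n - i) - eigval G n)" if "i < r" for i
      using that rn thresh_rank_iff[OF X, of "i + 1" d] eigval_antimono_Sym[OF G, of "n - i" n]
      by (simp add: r_def)
    then have "(\<Sum>i<rhat. (eigval X (i + 1) - d) * (eigval G (n - i) - eigval G n))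
        \<le> (\<Sum>i<r. (eigval X (i + 1) - d) * (eigval G (n - i) - eigval G n))"
      using le by (intro sum_mono2) auto
    then show ?thesis
      using le rn unfolding Y_def Yhat_def by (simp add: mat_inner_thresh_map[OF n Gc v])
  qed
  moreover have "Yhat \<in> spectral_set n v rhat"
    unfolding Yhat_def using n assms(3,4) v le
    by (intro thresh_map_in_spectral_set) (auto simp: eigenbasis_def r_def)
  moreover have "spectral_set n v rhat \<subseteq> Spectrahedron n"
    using spectral_set_subset_Spectrahedron[OF n v] le rn by simp
  ultimately show ?thesis
    by (auto simp: G_def)
qed

end
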